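(* Let $A$ and $B$ be (real) mixed Hodge structures and let $H\in\mathrm{Ext}^1_{MHS}(B,A)$, i.e. $H$ is a mixed Hodge structure fitting in an exact sequence of mixed Hodge structures $0\to A\to H\to B\to0$. Then $$\alpha(H)\ \ge\ \alpha(A)+\alpha(B).$$
   Context: A real mixed Hodge structure $H$ is a finite-dimensional real vector space $H_{\mathbf R}$ with an increasing exhaustive filtration $W_\bullet$ and a decreasing exhaustive filtration $F^\bullet$ on $H_{\mathbf C}=H_{\mathbf R}\otimes\mathbf C$, with conjugate $\overline F^\bullet$, such that $Gr_F^pGr_{\overline F}^qGr^W_nH_{\mathbf C}=0$ if $p+q\ne n$. Morphisms are real linear maps compatible (equivalently strictly compatible) with the filtrations. The level of $\mathbf R$-splitting of $H$ is $\alpha(H)=\frac12\sum_{p,q}(p+q)^2(h_H^{p,q}-s_H^{p,q})$, where $h_H^{p,q}=\dim_{\mathbf C}Gr_{\overline F}^qGr_F^pGr^W_{p+q}H_{\mathbf C}$ and $s_H^{p,q}=\dim_{\mathbf C}Gr_F^pGr_{\overline F}^qH_{\mathbf C}$. *)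

theory Defs
  imports "HOL-Analysis.Product_Vector" "HOL-Library.Groups_Big_Fun"
begin

text \<open>
  Complexification: the pair \<open>(x, y)\<close> stands for \<open>x \<otimes> 1 + y \<otimes> i\<close> in the tensor product of
  \<open>'a\<close> with the complex numbers over the reals.
\<close>

type_synonym 'a cplx = "'a \<times> 'a"

definition cscale :: "complex \<Rightarrow> 'a::real_vector cplx \<Rightarrow> 'a cplx" where
  "cscale c v = (Re c *\<^sub>R fst v - Im c *\<^sub>R snd v, Re c *\<^sub>R snd v + Im c *\<^sub>R fst v)"

definition conj_vec :: "'a::real_vector cplx \<Rightarrow> 'a cplx" where
  "conj_vec v = (fst v, - snd v)"

global_interpretation cplx: vector_space "cscale :: complex \<Rightarrow> 'a::real_vector cplx \<Rightarrow> 'a cplx"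
  by unfold_locales (simp_all add: cscale_def prod_eq_iff algebra_simps)

text \<open>
  A pair \<open>(U, V)\<close> of complex subspaces with \<open>V \<subseteq> U\<close> stands for the quotient space \<open>U / V\<close>,
  and a subspace of \<open>U / V\<close> is represented by its preimage in \<open>U\<close>. So \<open>induced S (U, V)\<close> is the
  subspace \<open>(S \<inter> U + V) / V\<close> that \<open>S\<close> induces on \<open>U / V\<close>, and the graded pieces of the induced
  filtrations are again such pairs, by \<open>(X / V) / (Y / V) = X / Y\<close>.
\<close>

type_synonym 'v subquot = "'v set \<times> 'v set"

definition induced :: "'v::ab_group_add set \<Rightarrow> 'v subquot \<Rightarrow> 'v set" where
  "induced S Q = {x + y | x y. x \<in> S \<inter> fst Q \<and> y \<in> snd Q}"

definition gr_dec :: "(int \<Rightarrow> 'v::ab_group_add set) \<Rightarrow> int \<Rightarrow> 'v subquot \<Rightarrow> 'v subquot" where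
  "gr_dec F p Q = (induced (F p) Q, induced (F (p + 1)) Q)"

definition gr_inc :: "(int \<Rightarrow> 'v::ab_group_add set) \<Rightarrow> int \<Rightarrow> 'v subquot \<Rightarrow> 'v subquot" where
  "gr_inc W n Q = (induced (W n) Q, induced (W (n - 1)) Q)"

definition subquot_zero :: "'v subquot \<Rightarrow> bool" where
  "subquot_zero Q \<longleftrightarrow> fst Q = snd Q"

definition subquot_dim :: "'a::real_vector cplx subquot \<Rightarrow> nat" where
  "subquot_dim Q = cplx.dim (fst Q) - cplx.dim (snd Q)"

abbreviation whole :: "'v::ab_group_add subquot" where
  "whole \<equiv> (UNIV, {0})"

text \<open>
  Passing to a subquotient in one step or in two steps induces the same subspace, so the iterated
  graded pieces below may use the filtrations of the ambient space throughout.
\<close>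

lemma induced_induced:
  assumes "cplx.subspace V'" "V \<subseteq> V'" "V' \<subseteq> U'" "U' \<subseteq> U" "cplx.subspace V" "cplx.subspace U'"
  shows "induced (induced S (U, V)) (U', V') = induced S (U', V')"
proof (intro equalityI subsetI)
  fix z assume "z \<in> induced (induced S (U, V)) (U', V')"
  then obtain s v y where z: "z = s + v + y" "s \<in> S" "v \<in> V" "s + v \<in> U'" "y \<in> V'"
    by (auto simp: induced_def)
  have "v \<in> U'"
    using z assms by blast
  then have "s \<in> U'"
    using z assms cplx.subspace_diff[of U' "s + v" v] by simp
  moreover have "v + y \<in> V'"
    using z assms by (intro cplx.subspace_add) auto
  moreover have "z = s + (v + y)"
    using z by (simp add: add.assoc)
  ultimately show "z \<in> induced S (U', V')"
    using z(2) unfolding induced_def fst_conv snd_conv by blast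
next
  fix z assume "z \<in> induced S (U', V')"
  then obtain s y where z: "z = s + y" "s \<in> S" "s \<in> U'" "y \<in> V'"
    by (auto simp: induced_def)
  moreover have "s \<in> induced S (U, V)"
    using z assms cplx.subspace_0[of V] unfolding induced_def fst_conv snd_conv
    by (intro CollectI exI[of _ s] exI[of _ 0]) auto
  ultimately show "z \<in> induced (induced S (U, V)) (U', V')"
    unfolding induced_def[of _ "(U', V')"] fst_conv snd_conv by blast
qed

record 'a hodge_data =
  Wfilt :: "int \<Rightarrow> 'a set"
  Ffilt :: "int \<Rightarrow> 'a cplx set"

definition WC :: "'a hodge_data \<Rightarrow> int \<Rightarrow> 'a cplx set" where
  "WC H n = Wfilt H n \<times> Wfilt H n"

definition Fbar :: "'a::real_vector hodge_data \<Rightarrow> int \<Rightarrow> 'a cplx set" where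
  "Fbar H q = conj_vec ` Ffilt H q"

text \<open>
  Exhaustiveness of the two filtrations is understood at both ends, that is, they are finite
  filtrations (the intersection conditions below). Without this, compatible maps need not be
  strictly compatible.
\<close>

definition real_MHS :: "'a::real_vector hodge_data \<Rightarrow> bool" where
  "real_MHS H \<longleftrightarrow>
     (\<exists>E :: 'a set. finite E \<and> span E = UNIV) \<and>
     (\<forall>n. subspace (Wfilt H n)) \<and> mono (Wfilt H) \<and>
     (\<Union>n. Wfilt H n) = UNIV \<and> (\<Inter>n. Wfilt H n) = {0} \<and>
     (\<forall>p. cplx.subspace (Ffilt H p)) \<and> antimono (Ffilt H) \<and>
     (\<Union>p. Ffilt H p) = UNIV \<and> (\<Inter>p. Ffilt H p) = {0} \<and>
     (\<forall>p q n. p + q \<noteq> n \<longrightarrow>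
        subquot_zero (gr_dec (Ffilt H) p (gr_dec (Fbar H) q (gr_inc (WC H) n whole))))"

definition MHS_morphism ::
  "'a::real_vector hodge_data \<Rightarrow> 'b::real_vector hodge_data \<Rightarrow> ('a \<Rightarrow> 'b) \<Rightarrow> bool" where
  "MHS_morphism H K f \<longleftrightarrow> linear f \<and>
     (\<forall>n. f ` Wfilt H n \<subseteq> Wfilt K n) \<and>
     (\<forall>p. map_prod f f ` Ffilt H p \<subseteq> Ffilt K p)"

text \<open>\<open>0 \<rightarrow> A \<rightarrow> H \<rightarrow> B \<rightarrow> 0\<close> is an exact sequence of mixed Hodge structures.\<close>

definition MHS_short_exact ::
  "'a::real_vector hodge_data \<Rightarrow> ('a \<Rightarrow> 'h) \<Rightarrow> 'h::real_vector hodge_data \<Rightarrow> ('h \<Rightarrow> 'b) \<Rightarrow>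
   'b::real_vector hodge_data \<Rightarrow> bool" where
  "MHS_short_exact A f H g B \<longleftrightarrow>
     MHS_morphism A H f \<and> MHS_morphism H B g \<and>
     inj f \<and> range f = {x. g x = 0} \<and> surj g"

definition hodge_h :: "'a::real_vector hodge_data \<Rightarrow> int \<Rightarrow> int \<Rightarrow> nat" where
  "hodge_h H p q =
     subquot_dim (gr_dec (Fbar H) q (gr_dec (Ffilt H) p (gr_inc (WC H) (p + q) whole)))"

definition hodge_s :: "'a::real_vector hodge_data \<Rightarrow> int \<Rightarrow> int \<Rightarrow> nat" where
  "hodge_s H p q = subquot_dim (gr_dec (Ffilt H) p (gr_dec (Fbar H) q whole))"

text \<open>For a mixed Hodge structure only finitely many of the summands are nonzero.\<close>

definition splitting_level :: "'a::real_vector hodge_data \<Rightarrow> real" where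
  "splitting_level H =
     1 / 2 * Sum_any (\<lambda>(p, q). (of_int (p + q))\<^sup>2 * (real (hodge_h H p q) - real (hodge_s H p q)))"

end

theory Submission
  imports Defs
begin

text \<open>
  Splitting \<open>\<Sum>(p + q)\<^sup>2 h^{p,q} = \<Sum>n\<^sup>2 dim Gr^W_n\<close> and summing \<open>\<Sum>(p + q)\<^sup>2 s^{p,q}\<close> twice by parts, the
  only contribution to the level that is not additive in exact sequences is
  \<open>- \<Sum>dim (F^p \<inter> Fbar^q)\<close>; since \<open>F^p \<inter> Fbar^q\<close> is left exact, the level is superadditive.

  The strictness needed for this is obtained from dimensions alone by a slope argument: for a complex
  subspace \<open>V\<close> of \<open>H\<close> with the induced filtrations, \<open>deg F + deg Fbar \<le> deg W\<close>, because \<open>F\<close> and \<open>Fbar\<close> are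
  opposed on \<open>Gr^W\<close>, with equality for \<open>V = H\<close>. In \<open>f(A)\<close> the filtrations of \<open>A\<close> attain equality, and
  enlarging any step of a filtration would increase \<open>deg F + deg Fbar - deg W\<close>.
\<close>

section \<open>Sums over integer intervals\<close>

lemma sum_telescope_int:
  fixes u :: "int \<Rightarrow> 'c::ab_group_add"
  assumes "a \<le> b"
  shows "(\<Sum>p\<in>{a..<b}. u p - u (p + 1)) = u a - u b"
  using assms
proof (induction b rule: int_ge_induct)
  case (step i)
  have "{a..<i + 1} = insert i {a..<i}"
    using step.hyps by auto
  then show ?case
    using step by simp
qed simp

lemma sum_telescope_int':
  fixes u :: "int \<Rightarrow> 'c::ab_group_add"
  assumes "a \<le> b"
  shows "(\<Sum>p\<in>{a<..b}. u p - u (p - 1)) = u b - u a"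
  using assms
proof (induction b rule: int_ge_induct)
  case (step i)
  have "{a<..i + 1} = insert (i + 1) {a<..i}"
    using step.hyps by auto
  then show ?case
    using step by simp
qed simp

text \<open>When \<open>d p q\<close> is the dimension of the intersection of step \<open>p\<close>
  of one filtration with step \<open>q\<close> of another, this mixed second difference is the
  dimension of the bigraded piece at \<open>(p, q)\<close>; see \<open>dim_gr_gr\<close>.\<close>

definition diff2 :: "(int \<Rightarrow> int \<Rightarrow> int) \<Rightarrow> int \<Rightarrow> int \<Rightarrow> int" where
  "diff2 d p q = d p q - d (p + 1) q - d p (q + 1) + d (p + 1) (q + 1)"

lemma sum_diff2:
  assumes "a \<le> a'" "b \<le> b'"
  shows "(\<Sum>p\<in>{a..<a'}. \<Sum>q\<in>{b..<b'}. diff2 d p q) = d a b - d a' b - d a b' + d a' b'"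
proof -
  have "(\<Sum>q\<in>{b..<b'}. diff2 d p q) = (d p b - d p b') - (d (p + 1) b - d (p + 1) b')" for p
    using sum_telescope_int[OF assms(2), of "\<lambda>q. d p q - d (p + 1) q"]
    by (simp add: diff2_def algebra_simps)
  then show ?thesis
    using sum_telescope_int[OF assms(1), of "\<lambda>p. d p b - d p b'"] by simp
qed

text \<open>The rectangle from \<open>(p, q)\<close> to a far corner lies strictly above the line
  \<open>i + j = n\<close>, so its double sum is zero, while the other three corners carry the
  stable value. On \<open>Gr^W_n\<close> this makes \<open>F p\<close> and \<open>G q\<close> meet
  trivially.\<close>

lemma diff2_zero_upper:
  assumes "\<And>p q. p + q \<noteq> n \<Longrightarrow> diff2 d p q = 0"
    and "\<And>p q. p \<ge> M \<or> q \<ge> M \<Longrightarrow> d p q = v"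
    and "p + q > n"
  shows "d p q = v"
proof -
  define P where "P = max p M"
  define Q where "Q = max q M"
  have "(\<Sum>i\<in>{p..<P}. \<Sum>j\<in>{q..<Q}. diff2 d i j) = 0"
    using assms(1,3) by (intro sum.neutral ballI) auto
  moreover have "d P q = v" "d p Q = v" "d P Q = v"
    by (auto simp: P_def Q_def assms(2))
  ultimately show ?thesis
    using sum_diff2[of p P q Q d] by (simp add: P_def Q_def)
qed

text \<open>Mirror image: the rectangle lies strictly below the line. Its upper ends are excluded,
  so \<open>p + q = n + 1\<close> is still allowed, and that is exactly the case covered by both
  lemmas.\<close>

lemma diff2_zero_lower:
  assumes "\<And>p q. p + q \<noteq> n \<Longrightarrow> diff2 d p q = 0"
    and "\<And>p q. p \<le> -M \<Longrightarrow> d p q = y q" "\<And>p q. q \<le> -M \<Longrightarrow> d p q = x p"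
    and "p + q \<le> n + 1"
  shows "x p + y q = d (-M) (-M) + d p q"
proof -
  define P where "P = min p (-M)"
  define Q where "Q = min q (-M)"
  have "(\<Sum>i\<in>{P..<p}. \<Sum>j\<in>{Q..<q}. diff2 d i j) = 0"
    using assms(1,4) by (intro sum.neutral ballI) auto
  moreover have "d P q = y q" "d p Q = x p" "d P Q = d (-M) (-M)"
    by (auto simp: P_def Q_def assms(2,3)) (metis assms(2,3) order_refl min.cobounded2)
  ultimately show ?thesis
    using sum_diff2[of P p Q q d] by (simp add: P_def Q_def)
qed

text \<open>Summation by parts in \<open>q\<close> and then in \<open>p\<close>: the vanishing of
  \<open>c\<close> on the border removes the boundary terms, and the mixed second difference of
  \<open>(p + q)^2\<close> is the constant 2.\<close>

lemma sum_diff2_square: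
  fixes c :: "int \<Rightarrow> int \<Rightarrow> int"
  assumes "\<And>p q. \<bar>p\<bar> \<ge> M \<or> \<bar>q\<bar> \<ge> M \<Longrightarrow> c p q = 0"
  shows "(\<Sum>p\<in>{-M..M}. \<Sum>q\<in>{-M..M}. (p + q)\<^sup>2 * diff2 c p q)
    = 2 * (\<Sum>p\<in>{-M..M}. \<Sum>q\<in>{-M..M}. c p q)"
proof -
  have shift: "(\<Sum>p\<in>{-M..M}. w p * e (p + 1)) = (\<Sum>p\<in>{-M..M}. w (p - 1) * e p)"
    if "\<And>p. \<bar>p\<bar> \<ge> M \<Longrightarrow> e p = 0" for w e :: "int \<Rightarrow> int"
  proof -
    have "(\<Sum>p\<in>{-M..M}. w p * e (p + 1)) = (\<Sum>p\<in>{-M + 1..M + 1}. w (p - 1) * e p)"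
      by (rule sum.reindex_bij_witness[of _ "\<lambda>p. p - 1" "\<lambda>p. p + 1"]) auto
    also have "\<dots> = (\<Sum>p\<in>{-M..M + 1}. w (p - 1) * e p)"
      using that by (intro sum.mono_neutral_left) auto
    also have "\<dots> = (\<Sum>p\<in>{-M..M}. w (p - 1) * e p)"
      using that by (intro sum.mono_neutral_right) auto
    finally show ?thesis .
  qed
  have parts: "(\<Sum>p\<in>{-M..M}. w p * (e p - e (p + 1))) = (\<Sum>p\<in>{-M..M}. (w p - w (p - 1)) * e p)"
    if "\<And>p. \<bar>p\<bar> \<ge> M \<Longrightarrow> e p = 0" for w e :: "int \<Rightarrow> int"
    using shift[of e w, OF that] by (simp add: algebra_simps sum_subtractf sum.distrib)
  have inner: "(\<Sum>q\<in>{-M..M}. (p + q)\<^sup>2 * diff2 c p q) =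
      (\<Sum>q\<in>{-M..M}. ((p + q)\<^sup>2 - (p + q - 1)\<^sup>2) * (c p q - c (p + 1) q))" for p
    using parts[of "\<lambda>q. c p q - c (p + 1) q" "\<lambda>q. (p + q)\<^sup>2"] assms
    by (simp add: diff2_def algebra_simps)
  have outer: "(\<Sum>p\<in>{-M..M}. ((p + q)\<^sup>2 - (p + q - 1)\<^sup>2) * (c p q - c (p + 1) q)) =
      (\<Sum>p\<in>{-M..M}. 2 * c p q)" for q
  proof -
    have "(p + q)\<^sup>2 - (p + q - 1)\<^sup>2 - ((p - 1 + q)\<^sup>2 - (p - 1 + q - 1)\<^sup>2) = 2" for p
      by (simp add: power2_eq_square algebra_simps)
    then show ?thesis
      using parts[of "\<lambda>p. c p q" "\<lambda>p. (p + q)\<^sup>2 - (p + q - 1)\<^sup>2"] assms by simp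
  qed
  have "(\<Sum>p\<in>{-M..M}. \<Sum>q\<in>{-M..M}. (p + q)\<^sup>2 * diff2 c p q) =
      (\<Sum>q\<in>{-M..M}. \<Sum>p\<in>{-M..M}. 2 * c p q)"
    unfolding inner by (subst sum.swap) (simp only: outer)
  then show ?thesis
    by (subst (asm) sum.swap) (simp add: sum_distrib_left)
qed

text \<open>Each index by which the range extends below \<open>-M\<close> adds one copy of
  \<open>N\<close>; extending it above \<open>M\<close> adds nothing. Different summation windows
  are compared this way in \<open>weight_eq\<close>.\<close>

lemma sum_stable_range:
  fixes y :: "int \<Rightarrow> int"
  assumes "\<And>q. q \<le> -M \<Longrightarrow> y q = N" "\<And>q. q \<ge> M \<Longrightarrow> y q = 0"
    and "M \<ge> 0" "a \<le> -M" "M \<le> b"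
  shows "(\<Sum>q\<in>{a<..b}. y q) = (\<Sum>q\<in>{-M<..M}. y q) + (-M - a) * N"
proof -
  have "(\<Sum>q\<in>{a<..b}. y q) = (\<Sum>q\<in>{a<..M}. y q)"
    using assms by (intro sum.mono_neutral_right) auto
  also have "{a<..M} = {a<..-M} \<union> {-M<..M}"
    using assms by auto
  also have "(\<Sum>q\<in>\<dots>. y q) = (\<Sum>q\<in>{a<..-M}. y q) + (\<Sum>q\<in>{-M<..M}. y q)"
    by (rule sum.union_disjoint) auto
  also have "(\<Sum>q\<in>{a<..-M}. y q) = (\<Sum>q\<in>{a<..-M}. N)"
    using assms by (intro sum.cong) auto
  finally show ?thesis
    using assms by simp
qed

section \<open>Finite-dimensional linear algebra\<close>

lemma induced_whole: "induced S whole = S"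
  by (auto simp: induced_def)

context vector_space
begin

lemma subspace_induced:
  assumes "subspace S" "subspace U" "subspace V"
  shows "subspace (induced S (U, V))"
  using subspace_sums[of "S \<inter> U" V] assms by (auto simp: induced_def subspace_inter)

lemma induced_subset:
  assumes "subspace U" "V \<subseteq> U"
  shows "induced S (U, V) \<subseteq> U"
  using assms by (auto simp: induced_def intro!: subspace_add)

lemma subset_induced:
  assumes "subspace S" "subspace U"
  shows "V \<subseteq> induced S (U, V)"
  using subspace_0[OF assms(1)] subspace_0[OF assms(2)] by (force simp: induced_def)

lemma induced_mono: "S \<subseteq> S' \<Longrightarrow> induced S (U, V) \<subseteq> induced S' (U, V)"
  by (auto simp: induced_def)

lemma induced_eq_lower:
  assumes "subspace V" "S \<subseteq> {0}" "subspace S" "subspace U"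
  shows "induced S (U, V) = V"
  using assms subset_induced[of S U V] by (auto simp: induced_def)

lemma induced_eq_upper:
  assumes "subspace U" "subspace V" "V \<subseteq> U"
  shows "induced UNIV (U, V) = U"
proof
  show "induced UNIV (U, V) \<subseteq> U"
    by (rule induced_subset) (use assms in auto)
  show "U \<subseteq> induced UNIV (U, V)"
    using subspace_0[OF assms(2)] by (force simp: induced_def)
qed

text \<open>The argument of \<open>induced_induced\<close>, carried out over an arbitrary
  field.\<close>

lemma induced_refine:
  assumes "subspace V" "subspace U" "V \<subseteq> V'" "V' \<subseteq> U'" "U' \<subseteq> U" "subspace V'" "subspace U'"
  shows "induced (induced S (U, V)) (U', V') = induced S (U', V')"
proof (intro equalityI subsetI)
  fix z assume "z \<in> induced (induced S (U, V)) (U', V')"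
  then obtain s v y where z: "z = s + v + y" "s \<in> S" "v \<in> V" "s + v \<in> U'" "y \<in> V'"
    by (auto simp: induced_def)
  then have "s \<in> U'"
    using subspace_diff[OF assms(7), of "s + v" v] assms by auto
  moreover have "v + y \<in> V'"
    using z assms by (intro subspace_add) auto
  ultimately show "z \<in> induced S (U', V')"
    using z(1,2) unfolding induced_def by (force simp: add.assoc)
next
  fix z assume "z \<in> induced S (U', V')"
  then obtain s y where z: "z = s + y" "s \<in> S" "s \<in> U'" "y \<in> V'"
    by (auto simp: induced_def)
  moreover have "s \<in> induced S (U, V)"
    using z assms subspace_0[of V] by (force simp: induced_def)
  ultimately show "z \<in> induced (induced S (U, V)) (U', V')"
    unfolding induced_def[of _ "(U', V')"] by auto
qed

end

context finite_dimensional_vector_space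
begin

lemma dim_Int_zero:
  "dim ({0} \<inter> S) = 0" "dim (S \<inter> {0}) = 0"
  "dim ({0} \<inter> S \<inter> T) = 0" "dim (S \<inter> {0} \<inter> T) = 0"
  by auto

lemma dim_induced:
  assumes "subspace S" "subspace U" "subspace V" "V \<subseteq> U"
  shows "int (dim (induced S (U, V))) = int (dim (S \<inter> U)) + int (dim V) - int (dim (S \<inter> V))"
proof -
  have "S \<inter> U \<inter> V = S \<inter> V"
    using assms by auto
  then show ?thesis
    using dim_sums_Int[of "S \<inter> U" V] assms by (simp add: induced_def subspace_inter)
qed

text \<open>By \<open>induced_refine\<close>, \<open>G\<close> may be replaced by the filtration it
  induces on \<open>U / V\<close>. Then \<open>dim_induced\<close> applies to both of its steps, and
  the common term \<open>dim (X (p + 1))\<close> cancels in the difference.\<close>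

lemma dim_gr_gr:
  assumes F: "\<And>p. subspace (F p)" "antimono F" and G: "\<And>q. subspace (G q)" "antimono G"
    and UV: "subspace U" "subspace V" "V \<subseteq> U"
  shows "snd (gr_dec G q (gr_dec F p (U, V))) \<subseteq> fst (gr_dec G q (gr_dec F p (U, V)))" (is ?sub)
    and "int (dim (fst (gr_dec G q (gr_dec F p (U, V))))) - int (dim (snd (gr_dec G q (gr_dec F p (U, V)))))
      = diff2 (\<lambda>p q. int (dim (induced (F p) (U, V) \<inter> induced (G q) (U, V)))) p q" (is ?dim)
proof -
  define X where "X p = induced (F p) (U, V)" for p
  define Y where "Y q = induced (G q) (U, V)" for q
  have X: "subspace (X p)" "V \<subseteq> X p" "X p \<subseteq> U" for p
    unfolding X_def using UV F
    by (simp_all only: subspace_induced subset_induced induced_subset)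
  have Y: "subspace (Y p)" for p
    using UV G by (auto simp: Y_def intro!: subspace_induced)
  have X_mono: "X (p + 1) \<subseteq> X p" for p
    unfolding X_def by (rule induced_mono) (rule antimonoD[OF F(2)], simp)
  have refine: "induced (G q) (X p, X (p + 1)) = induced (Y q) (X p, X (p + 1))" for q
    unfolding Y_def by (rule induced_refine[symmetric]) (use UV X X_mono in auto)
  have gr: "gr_dec G q (gr_dec F p (U, V)) =
      (induced (Y q) (X p, X (p + 1)), induced (Y (q + 1)) (X p, X (p + 1)))"
    unfolding refine[symmetric] by (simp add: gr_dec_def X_def)
  have dim: "int (dim (induced (Y q) (X p, X (p + 1)))) =
      int (dim (X p \<inter> Y q)) + int (dim (X (p + 1))) - int (dim (X (p + 1) \<inter> Y q))" for q
    using dim_induced[OF Y X(1) X(1) X_mono] by (simp add: Int_commute)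
  show ?dim
    unfolding gr fst_conv snd_conv dim diff2_def X_def[symmetric] Y_def[symmetric] by simp
  have "Y (q + 1) \<subseteq> Y q"
    unfolding Y_def by (rule induced_mono) (rule antimonoD[OF G(2)], simp)
  then show ?sub
    unfolding gr by (simp add: induced_mono)
qed

text \<open>Dimensions are bounded, so some step has least and some step has greatest dimension.
  Comparable subspaces of equal dimension coincide, so the former lies in every step and the latter
  contains every step.\<close>

lemma antimono_subspaces_stable:
  fixes F :: "int \<Rightarrow> 'b set"
  assumes sub: "\<And>p. subspace (F p)" and "antimono F"
    and "(\<Union>p. F p) = UNIV" "(\<Inter>p. F p) = {0}"
  obtains m where "\<And>p. p \<le> -m \<Longrightarrow> F p = UNIV" "\<And>p. p \<ge> m \<Longrightarrow> F p = {0}"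
proof -
  obtain a where a: "dim (F a) \<le> dim (F p)" for p
    using ex_has_least_nat[of "\<lambda>_. True" "undefined" "\<lambda>p. dim (F p)"] by auto
  have "\<forall>p. True \<longrightarrow> dim (F p) < dimension + 1"
    using dim_subset_UNIV by (simp add: less_Suc_eq_le)
  then obtain b where b: "dim (F p) \<le> dim (F b)" for p
    using ex_has_greatest_nat[of "\<lambda>_. True" "undefined" "\<lambda>p. dim (F p)" "dimension + 1"] by auto
  have anti: "p \<le> q \<Longrightarrow> F q \<subseteq> F p" for p q
    using \<open>antimono F\<close> by (rule antimonoD)
  have "F a \<subseteq> F p" for p
  proof (cases "p \<le> a")
    case False
    then have "F p = F a"
      using anti[of a p] by (intro subspace_dim_equal sub a) auto
    then show ?thesis by simp
  qed (rule anti)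
  then have "F a \<subseteq> {0}"
    using assms(4) by blast
  then have low: "F p = {0}" if "p \<ge> a" for p
    using anti[OF that] subspace_0[OF sub] by blast
  have "F p \<subseteq> F b" for p
  proof (cases "b \<le> p")
    case False
    then have "F b = F p"
      using anti[of p b] by (intro subspace_dim_equal sub b) auto
    then show ?thesis by simp
  qed (rule anti)
  then have "F b = UNIV"
    using assms(3) by blast
  then have "F p = UNIV" if "p \<le> b" for p
    using anti[OF that] by blast
  with low show thesis
    by (intro that[of "max a (-b)"]) auto
qed

end

text \<open>A linear section \<open>r\<close> of \<open>f\<close> over the image of \<open>S\<close>
  splits \<open>S\<close> into its kernel part and a copy of that image.\<close>

lemma (in finite_dimensional_vector_space_pair) rank_nullity:
  assumes f: "Vector_Spaces.linear s1 s2 f" and S: "vs1.subspace S"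
  shows "vs1.dim S = vs1.dim (S \<inter> {x. f x = 0}) + vs2.dim (f ` S)"
proof -
  interpret f: Vector_Spaces.linear s1 s2 f by fact
  obtain r where r: "r ` UNIV \<subseteq> S" "Vector_Spaces.linear s2 s1 r" "\<And>v. v \<in> f ` S \<Longrightarrow> f (r v) = v"
    using linear_exists_right_inverse_on[OF f S] by blast
  interpret r: Vector_Spaces.linear s2 s1 r by fact
  let ?K = "S \<inter> {x. f x = 0}" and ?T = "r ` f ` S"
  have K: "vs1.subspace ?K"
    using S f.subspace_kernel by (rule vs1.subspace_inter)
  have T: "vs1.subspace ?T"
    by (intro r.subspace_image f.subspace_image S)
  have "inj_on f ?T"
    by (rule inj_on_inverseI[where g = r]) (auto simp: r(3))
  moreover have "f ` ?T = f ` S"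
    using r(3) by (auto simp: image_iff)
  ultimately have "vs2.dim (f ` S) = vs1.dim ?T"
    using dim_image_eq[OF f, of ?T] T by (simp add: vs1.span_eq_iff[THEN iffD2])
  moreover have "?K \<inter> ?T = {0}"
    using r(3) vs1.subspace_0[OF K] vs1.subspace_0[OF T] by auto
  moreover have "{x + y | x y. x \<in> ?K \<and> y \<in> ?T} = S"
  proof (intro equalityI subsetI)
    fix z assume "z \<in> S"
    then have "z - r (f z) \<in> ?K" "r (f z) \<in> ?T"
      using r S by (auto simp: f.diff intro!: vs1.subspace_diff)
    then show "z \<in> {x + y | x y. x \<in> ?K \<and> y \<in> ?T}"
      by (intro CollectI exI[of _ "z - r (f z)"] exI[of _ "r (f z)"]) simp
  next
    fix z assume "z \<in> {x + y | x y. x \<in> ?K \<and> y \<in> ?T}"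
    then obtain x y where "z = x + y" "x \<in> S" "y \<in> range r"
      by auto
    then show "z \<in> S"
      using r(1) by (auto intro!: vs1.subspace_add[OF S])
  qed
  ultimately show ?thesis
    using vs1.dim_sums_Int[OF K T] by simp
qed

section \<open>Opposed filtrations\<close>

text \<open>The role of \<open>Fbar\<close> is taken by \<open>G\<close>. One bound \<open>M\<close>
  serves all three filtrations, so that several spaces can share the same summation ranges.\<close>

locale trifiltered_space = finite_dimensional_vector_space scale Basis
  for scale :: "'k::field \<Rightarrow> 'v::ab_group_add \<Rightarrow> 'v" and Basis :: "'v set" +
  fixes W F G :: "int \<Rightarrow> 'v set" and M :: int
  assumes M_nonneg: "0 \<le> M"
    and subspace_W: "subspace (W n)" and W_mono: "mono W"
    and W_low: "n \<le> -M \<Longrightarrow> W n = {0}" and W_high: "n \<ge> M \<Longrightarrow> W n = UNIV"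
    and subspace_F: "subspace (F p)" and F_antimono: "antimono F"
    and F_low: "p \<le> -M \<Longrightarrow> F p = UNIV" and F_high: "p \<ge> M \<Longrightarrow> F p = {0}"
    and subspace_G: "subspace (G q)" and G_antimono: "antimono G"
    and G_low: "q \<le> -M \<Longrightarrow> G q = UNIV" and G_high: "q \<ge> M \<Longrightarrow> G q = {0}"
    and gr_zero: "p + q \<noteq> n \<Longrightarrow> subquot_zero (gr_dec F p (gr_dec G q (gr_inc W n whole)))"
begin

text \<open>Subspaces of \<open>Gr^W_n\<close> are kept as preimages in \<open>W n\<close>. Zero
  therefore appears as \<open>W (n - 1)\<close>, and every dimension is too large by
  \<open>W_dim (n - 1)\<close>.\<close>

definition gr_F :: "int \<Rightarrow> int \<Rightarrow> 'v set" where
  "gr_F n p = induced (F p) (W n, W (n - 1))"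

definition gr_G :: "int \<Rightarrow> int \<Rightarrow> 'v set" where
  "gr_G n q = induced (G q) (W n, W (n - 1))"

definition gr_FG_dim :: "int \<Rightarrow> int \<Rightarrow> int \<Rightarrow> int" where
  "gr_FG_dim n p q = int (dim (gr_F n p \<inter> gr_G n q))"

definition W_dim :: "int \<Rightarrow> int" where
  "W_dim n = int (dim (W n))"

definition FG_dim :: "int \<Rightarrow> int \<Rightarrow> int" where
  "FG_dim p q = int (dim (F p \<inter> G q))"

lemma W_step: "W (n - 1) \<subseteq> W n"
  using W_mono by (rule monoD) simp

lemma gr_W: "gr_inc W n whole = (W n, W (n - 1))"
  by (simp add: gr_inc_def induced_whole)

lemma gr_F_gr_G_simps:
  "subspace (gr_F n p)" "subspace (gr_G n q)"
  "gr_F n p \<subseteq> W n" "gr_G n q \<subseteq> W n" "W (n - 1) \<subseteq> gr_F n p" "W (n - 1) \<subseteq> gr_G n q"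
  "p \<le> -M \<Longrightarrow> gr_F n p = W n" "q \<le> -M \<Longrightarrow> gr_G n q = W n"
  "p \<ge> M \<Longrightarrow> gr_F n p = W (n - 1)" "q \<ge> M \<Longrightarrow> gr_G n q = W (n - 1)"
  unfolding gr_F_def gr_G_def
  using subspace_W subspace_F subspace_G W_step[of n]
  by (simp_all add: subspace_induced subset_induced induced_subset induced_eq_lower induced_eq_upper
      F_low F_high G_low G_high)

lemma gr_FG_dim_simps:
  "p \<le> -M \<Longrightarrow> gr_FG_dim n p q = int (dim (gr_G n q))" "q \<le> -M \<Longrightarrow> gr_FG_dim n p q = int (dim (gr_F n p))"
  "p \<ge> M \<or> q \<ge> M \<Longrightarrow> gr_FG_dim n p q = W_dim (n - 1)"
  using gr_F_gr_G_simps(3-6)[of n] by (auto simp: gr_FG_dim_def W_dim_def gr_F_gr_G_simps(7-) Int_absorb1 Int_absorb2)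

lemma diff2_gr_FG_dim_eq_0:
  assumes "p + q \<noteq> n"
  shows "diff2 (gr_FG_dim n) p q = 0"
proof -
  \<comment> \<open>In \<open>gr_zero\<close> the grading by \<open>G\<close> comes first, so
    \<open>dim_gr_gr\<close> is used with \<open>F\<close> and \<open>G\<close> exchanged; the
    second difference is symmetric.\<close>
  have "int (dim (fst (gr_dec F p (gr_dec G q (W n, W (n - 1)))))) -
      int (dim (snd (gr_dec F p (gr_dec G q (W n, W (n - 1)))))) =
      diff2 (\<lambda>q p. int (dim (induced (G q) (W n, W (n - 1)) \<inter> induced (F p) (W n, W (n - 1))))) q p"
    by (intro dim_gr_gr subspace_W subspace_F subspace_G F_antimono G_antimono W_step)
  then show ?thesis
    using gr_zero[OF assms]
    by (simp add: gr_W subquot_zero_def diff2_def gr_FG_dim_def gr_F_def gr_G_def Int_commute)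
qed

text \<open>One half of opposedness: \<open>F p\<close> and \<open>G (n + 1 - p)\<close> are
  complementary on \<open>Gr^W_n\<close>. The other half, on dimensions, is
  \<open>dim_gr_F_plus_dim_gr_G\<close>.\<close>

lemma gr_F_Int_gr_G:
  assumes "p + q = n + 1"
  shows "gr_F n p \<inter> gr_G n q = W (n - 1)"
proof -
  have "gr_FG_dim n p q = W_dim (n - 1)"
    by (rule diff2_zero_upper[where n = n and M = M]) (auto simp: diff2_gr_FG_dim_eq_0 gr_FG_dim_simps assms)
  then show ?thesis
    using gr_F_gr_G_simps
    by (intro subspace_dim_equal[symmetric] subspace_inter subspace_W) (auto simp: gr_FG_dim_def W_dim_def)
qed

lemma dim_gr_F_plus_dim_gr_G:
  assumes "p + q = n + 1"
  shows "int (dim (gr_F n p)) + int (dim (gr_G n q)) = W_dim n + W_dim (n - 1)"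
proof -
  have "int (dim (gr_F n p)) + int (dim (gr_G n q)) = gr_FG_dim n (-M) (-M) + gr_FG_dim n p q"
    by (rule diff2_zero_lower[where n = n and M = M and x = "\<lambda>p. int (dim (gr_F n p))" and y = "\<lambda>q. int (dim (gr_G n q))"])
      (auto simp: diff2_gr_FG_dim_eq_0 gr_FG_dim_simps assms)
  moreover have "gr_FG_dim n (-M) (-M) = W_dim n"
    by (simp add: gr_FG_dim_def W_dim_def gr_F_gr_G_simps)
  moreover have "gr_FG_dim n p q = W_dim (n - 1)"
    by (simp add: gr_FG_dim_def W_dim_def gr_F_Int_gr_G[OF assms])
  ultimately show ?thesis by simp
qed

text \<open>
  Up to an affine normalisation this is
  \<open>deg F|V + deg G|V - deg W|V\<close>, where \<open>deg F = (\<Sum>p. p * dim Gr_F^p)\<close> and \<open>F|V\<close> is the filtration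
  induced on \<open>V\<close>; summation by parts makes it linear in the dimensions of the filtration steps.
\<close>

definition weight :: "'v set \<Rightarrow> int" where
  "weight V = (\<Sum>p\<in>{-M<..M}. int (dim (F p \<inter> V)) + int (dim (G p \<inter> V)) + int (dim (W (p - 1) \<inter> V)))"

text \<open>Telescoping over \<open>n\<close> distributes each dimension over the pieces
  \<open>Gr^W_n\<close> of \<open>V\<close>, and \<open>F p\<close> is paired with the step
  \<open>G (n + 1 - p)\<close> opposed to it. Each summand can then be bounded separately.\<close>

lemma weight_eq:
  assumes V: "subspace V"
  shows "weight V - 3 * M * int (dim V) =
    (\<Sum>n\<in>{-M<..M}. \<Sum>p\<in>{-2 * M<..2 * M}.
      (int (dim (F p \<inter> W n \<inter> V)) - int (dim (F p \<inter> W (n - 1) \<inter> V)))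
      + (int (dim (G (n + 1 - p) \<inter> W n \<inter> V)) - int (dim (G (n + 1 - p) \<inter> W (n - 1) \<inter> V)))
      - (int (dim (W n \<inter> V)) - int (dim (W (n - 1) \<inter> V))))"
proof -
  define N where "N n = int (dim (W n \<inter> V)) - int (dim (W (n - 1) \<inter> V))" for n
  define x where "x n p = int (dim (F p \<inter> W n \<inter> V)) - int (dim (F p \<inter> W (n - 1) \<inter> V))" for n p
  define y where "y n q = int (dim (G q \<inter> W n \<inter> V)) - int (dim (G q \<inter> W (n - 1) \<inter> V))" for n q
  have x: "p \<le> -M \<Longrightarrow> x n p = N n" "p \<ge> M \<Longrightarrow> x n p = 0" for n p
    by (auto simp: x_def N_def F_low F_high dim_Int_zero)
  have y: "p \<le> -M \<Longrightarrow> y n p = N n" "p \<ge> M \<Longrightarrow> y n p = 0" for n p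
    by (auto simp: y_def N_def G_low G_high dim_Int_zero)
  \<comment> \<open>The window of length \<open>4 * M\<close> is wide enough for both
    \<open>p\<close> and \<open>n + 1 - p\<close> to run through all of \<open>{-M<..M}\<close>. The
    stable values contribute \<open>M\<close>, \<open>M - n\<close> and \<open>-4 * M\<close> copies
    of \<open>N n\<close>.\<close>
  have inner: "(\<Sum>p\<in>{-2 * M<..2 * M}. x n p + y n (n + 1 - p) - N n) =
      (\<Sum>p\<in>{-M<..M}. x n p) + (\<Sum>p\<in>{-M<..M}. y n p) - (2 * M + n) * N n"
    if n: "n \<in> {-M<..M}" for n
  proof -
    have "(\<Sum>p\<in>{-2 * M<..2 * M}. x n p) = (\<Sum>p\<in>{-M<..M}. x n p) + M * N n"
      using sum_stable_range[of M "x n" "N n" "-2 * M" "2 * M"] x M_nonneg by simp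
    moreover have "(\<Sum>p\<in>{-2 * M<..2 * M}. y n (n + 1 - p)) = (\<Sum>q\<in>{n - 2 * M<..n + 2 * M}. y n q)"
      by (rule sum.reindex_bij_witness[of _ "\<lambda>q. n + 1 - q" "\<lambda>p. n + 1 - p"]) auto
    moreover have "\<dots> = (\<Sum>q\<in>{-M<..M}. y n q) + (M - n) * N n"
      using sum_stable_range[of M "y n" "N n" "n - 2 * M" "n + 2 * M"] y M_nonneg n by simp
    ultimately show ?thesis
      using M_nonneg by (simp add: sum.distrib sum_subtractf algebra_simps)
  qed
  have sum_x: "(\<Sum>n\<in>{-M<..M}. x n p) = int (dim (F p \<inter> V))" for p
    using sum_telescope_int'[of "-M" M "\<lambda>n. int (dim (F p \<inter> W n \<inter> V))"] M_nonneg
    by (simp add: x_def W_low W_high dim_Int_zero)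
  have sum_y: "(\<Sum>n\<in>{-M<..M}. y n p) = int (dim (G p \<inter> V))" for p
    using sum_telescope_int'[of "-M" M "\<lambda>n. int (dim (G p \<inter> W n \<inter> V))"] M_nonneg
    by (simp add: y_def W_low W_high dim_Int_zero)
  \<comment> \<open>Summation by parts; the boundary term at \<open>n = M\<close>, where
    \<open>W\<close> is the whole space, yields the normalising constant
    \<open>3 * M * dim V\<close>.\<close>
  have sum_N: "(\<Sum>n\<in>{-M<..M}. (2 * M + n) * N n) =
      3 * M * int (dim V) - (\<Sum>n\<in>{-M<..M}. int (dim (W (n - 1) \<inter> V)))"
  proof -
    have "(\<Sum>n\<in>{-M<..M}. (2 * M + n) * N n) =
      (\<Sum>n\<in>{-M<..M}. ((2 * M + n) * int (dim (W n \<inter> V)) - (2 * M + (n - 1)) * int (dim (W (n - 1) \<inter> V)))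
        - int (dim (W (n - 1) \<inter> V)))"
      by (rule sum.cong) (simp_all add: N_def algebra_simps)
    then show ?thesis
      using sum_telescope_int'[of "-M" M "\<lambda>n. (2 * M + n) * int (dim (W n \<inter> V))"] M_nonneg
      by (simp add: sum_subtractf W_low W_high dim_Int_zero)
  qed
  have "(\<Sum>n\<in>{-M<..M}. \<Sum>p\<in>{-2 * M<..2 * M}. x n p + y n (n + 1 - p) - N n) =
      (\<Sum>n\<in>{-M<..M}. (\<Sum>p\<in>{-M<..M}. x n p) + (\<Sum>p\<in>{-M<..M}. y n p) - (2 * M + n) * N n)"
    by (rule sum.cong[OF refl inner])
  also have "\<dots> = (\<Sum>p\<in>{-M<..M}. int (dim (F p \<inter> V))) + (\<Sum>p\<in>{-M<..M}. int (dim (G p \<inter> V)))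
      - (\<Sum>n\<in>{-M<..M}. (2 * M + n) * N n)"
    using sum_x sum_y sum.swap[of x "{-M<..M}" "{-M<..M}"] sum.swap[of y "{-M<..M}" "{-M<..M}"]
    by (simp add: sum.distrib sum_subtractf)
  also have "\<dots> = weight V - 3 * M * int (dim V)"
    unfolding sum_N weight_def by (simp add: sum.distrib)
  finally show ?thesis
    by (simp add: x_def y_def N_def)
qed

text \<open>No summand of \<open>weight_eq\<close> is positive: the filtrations that
  \<open>F\<close> and \<open>G\<close> induce on \<open>Gr^W_n\<close> of \<open>V\<close> inject
  into opposed ones. Complementary steps thus meet trivially, and their dimensions add up to at most
  that of the piece.\<close>

lemma weight_le:
  assumes V: "subspace V"
  shows "weight V \<le> 3 * M * int (dim V)"
proof -
  have "(int (dim (F p \<inter> W n \<inter> V)) - int (dim (F p \<inter> W (n - 1) \<inter> V)))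
      + (int (dim (G q \<inter> W n \<inter> V)) - int (dim (G q \<inter> W (n - 1) \<inter> V)))
      \<le> int (dim (W n \<inter> V)) - int (dim (W (n - 1) \<inter> V))"
    if pq: "p + q = n + 1" for n p q
  proof -
    let ?U = "W n \<inter> V" and ?U' = "W (n - 1) \<inter> V"
    define XV where "XV = induced (F p) (?U, ?U')"
    define YV where "YV = induced (G q) (?U, ?U')"
    have U: "subspace ?U" "subspace ?U'" "?U' \<subseteq> ?U"
      using V subspace_W W_step[of n] by (auto intro: subspace_inter)
    have sub: "subspace XV" "subspace YV" "XV \<subseteq> ?U" "YV \<subseteq> ?U"
      unfolding XV_def YV_def using U subspace_F subspace_G
      by (simp_all only: subspace_induced induced_subset)
    have "XV \<subseteq> gr_F n p" "YV \<subseteq> gr_G n q"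
      by (auto simp: XV_def YV_def gr_F_def gr_G_def induced_def)
    then have "XV \<inter> YV \<subseteq> ?U'"
      using gr_F_Int_gr_G[OF pq] sub by blast
    then have "dim (XV \<inter> YV) \<le> dim ?U'"
      by (rule dim_subset)
    moreover have "dim {a + b | a b. a \<in> XV \<and> b \<in> YV} \<le> dim ?U"
      using sub(3,4) subspace_add[OF U(1)] by (intro dim_subset) blast
    ultimately have "int (dim XV) + int (dim YV) \<le> int (dim ?U) + int (dim ?U')"
      using dim_sums_Int[OF sub(1,2)] by linarith
    moreover have "int (dim XV) = int (dim (F p \<inter> ?U)) + int (dim ?U') - int (dim (F p \<inter> ?U'))"
      unfolding XV_def by (rule dim_induced[OF subspace_F U])
    moreover have "int (dim YV) = int (dim (G q \<inter> ?U)) + int (dim ?U') - int (dim (G q \<inter> ?U'))"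
      unfolding YV_def by (rule dim_induced[OF subspace_G U])
    ultimately show ?thesis
      by (simp add: Int_assoc)
  qed
  then have "weight V - 3 * M * int (dim V) \<le> 0"
    unfolding weight_eq[OF V] by (intro sum_nonpos) (simp add: algebra_simps)
  then show ?thesis by simp
qed

text \<open>On the whole space complementary steps also span, so every summand of
  \<open>weight_eq\<close> vanishes.\<close>

lemma weight_UNIV: "weight UNIV = 3 * M * int (dim UNIV)"
proof -
  have "(int (dim (F p \<inter> W n)) - int (dim (F p \<inter> W (n - 1))))
      + (int (dim (G q \<inter> W n)) - int (dim (G q \<inter> W (n - 1)))) = W_dim n - W_dim (n - 1)"
    if pq: "p + q = n + 1" for n p q
    using dim_gr_F_plus_dim_gr_G[OF pq]
      dim_induced[OF subspace_F subspace_W subspace_W W_step, of p n]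
      dim_induced[OF subspace_G subspace_W subspace_W W_step, of q n]
    by (simp add: gr_F_def gr_G_def W_dim_def)
  then have "weight UNIV - 3 * M * int (dim UNIV) = 0"
    unfolding weight_eq[OF subspace_UNIV]
    by (intro sum.neutral ballI) (simp add: W_dim_def)
  then show ?thesis by simp
qed

section \<open>The level expressed through dimensions of filtration steps\<close>

lemma dim_gr_gr_gr:
  "snd (gr_dec G q (gr_dec F p (gr_inc W n whole))) \<subseteq> fst (gr_dec G q (gr_dec F p (gr_inc W n whole)))"
  "int (dim (fst (gr_dec G q (gr_dec F p (gr_inc W n whole))))) -
   int (dim (snd (gr_dec G q (gr_dec F p (gr_inc W n whole))))) = diff2 (gr_FG_dim n) p q"
  unfolding gr_W gr_FG_dim_def gr_F_def gr_G_def
  by (intro dim_gr_gr subspace_W subspace_F subspace_G F_antimono G_antimono W_step)+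

lemma dim_gr_F_gr_G:
  "snd (gr_dec F p (gr_dec G q whole)) \<subseteq> fst (gr_dec F p (gr_dec G q whole))"
  "int (dim (fst (gr_dec F p (gr_dec G q whole)))) -
   int (dim (snd (gr_dec F p (gr_dec G q whole)))) = diff2 FG_dim p q"
proof -
  show "snd (gr_dec F p (gr_dec G q whole)) \<subseteq> fst (gr_dec F p (gr_dec G q whole))"
    by (intro dim_gr_gr subspace_F subspace_G F_antimono G_antimono subspace_UNIV subspace_single_0) simp
  have "int (dim (fst (gr_dec F p (gr_dec G q whole)))) -
      int (dim (snd (gr_dec F p (gr_dec G q whole)))) =
      diff2 (\<lambda>q p. int (dim (induced (G q) whole \<inter> induced (F p) whole))) q p"
    by (intro dim_gr_gr subspace_F subspace_G F_antimono G_antimono subspace_UNIV subspace_single_0) simp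
  then show "int (dim (fst (gr_dec F p (gr_dec G q whole)))) -
   int (dim (snd (gr_dec F p (gr_dec G q whole)))) = diff2 FG_dim p q"
    by (simp add: diff2_def FG_dim_def induced_whole Int_commute)
qed

lemma diff2_outside:
  assumes "(p, q) \<notin> {-M..M} \<times> {-M..M}"
  shows "diff2 (gr_FG_dim n) p q = 0" "diff2 FG_dim p q = 0"
  using assms
  by (auto simp: diff2_def not_le gr_FG_dim_simps FG_dim_def F_low F_high G_low G_high dim_Int_zero)

lemma sum_diff2_gr_FG_dim: "(\<Sum>p\<in>{-M..M}. \<Sum>q\<in>{-M..M}. diff2 (gr_FG_dim n) p q) = W_dim n - W_dim (n - 1)"
proof -
  have "{-M..M} = {-M..<M + 1}"
    by auto
  then show ?thesis
    using sum_diff2[of "-M" "M + 1" "-M" "M + 1" "gr_FG_dim n"] M_nonneg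
    by (simp add: gr_FG_dim_simps gr_F_gr_G_simps) (simp add: W_dim_def)
qed

text \<open>The bigraded pieces of \<open>Gr^W_n\<close> sit on \<open>p + q = n\<close>, so summing
  over all \<open>n\<close> adds only zeros. Hence the Hodge number part of the level depends on the
  dimensions of \<open>W\<close> alone.\<close>

lemma sum_square_diff2_gr_FG_dim:
  "(\<Sum>p\<in>{-M..M}. \<Sum>q\<in>{-M..M}. (p + q)\<^sup>2 * diff2 (gr_FG_dim (p + q)) p q) =
   (\<Sum>n\<in>{-2 * M..2 * M}. n\<^sup>2 * (W_dim n - W_dim (n - 1)))"
proof -
  have "(p + q)\<^sup>2 * diff2 (gr_FG_dim (p + q)) p q = (\<Sum>n\<in>{-2 * M..2 * M}. n\<^sup>2 * diff2 (gr_FG_dim n) p q)"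
    if "p \<in> {-M..M}" "q \<in> {-M..M}" for p q
  proof -
    have "(\<Sum>n\<in>{-2 * M..2 * M}. n\<^sup>2 * diff2 (gr_FG_dim n) p q) = (\<Sum>n\<in>{p + q}. n\<^sup>2 * diff2 (gr_FG_dim n) p q)"
      using that by (intro sum.mono_neutral_right) (auto simp: diff2_gr_FG_dim_eq_0)
    then show ?thesis by simp
  qed
  then have "(\<Sum>p\<in>{-M..M}. \<Sum>q\<in>{-M..M}. (p + q)\<^sup>2 * diff2 (gr_FG_dim (p + q)) p q) =
      (\<Sum>p\<in>{-M..M}. \<Sum>q\<in>{-M..M}. \<Sum>n\<in>{-2 * M..2 * M}. n\<^sup>2 * diff2 (gr_FG_dim n) p q)"
    by (intro sum.cong refl) auto
  also have "\<dots> = (\<Sum>n\<in>{-2 * M..2 * M}. \<Sum>p\<in>{-M..M}. \<Sum>q\<in>{-M..M}. n\<^sup>2 * diff2 (gr_FG_dim n) p q)"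
    by (subst sum.swap, subst (2) sum.swap) (rule refl)
  also have "\<dots> = (\<Sum>n\<in>{-2 * M..2 * M}. n\<^sup>2 * (W_dim n - W_dim (n - 1)))"
    by (simp add: sum_distrib_left[symmetric] sum_diff2_gr_FG_dim)
  finally show ?thesis .
qed

text \<open>Twice the splitting level, kept as an integer; see
  \<open>splitting_level_eq\<close>.\<close>

definition level :: int where
  "level = (\<Sum>p\<in>{-M..M}. \<Sum>q\<in>{-M..M}. (p + q)\<^sup>2 * (diff2 (gr_FG_dim (p + q)) p q - diff2 FG_dim p q))"

lemma level_eq:
  "level = (\<Sum>n\<in>{-2 * M..2 * M}. n\<^sup>2 * (W_dim n - W_dim (n - 1)))
    - (\<Sum>p\<in>{-M..M}. \<Sum>q\<in>{-M..M}. (p + q)\<^sup>2 * diff2 FG_dim p q)"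
  unfolding level_def sum_square_diff2_gr_FG_dim[symmetric] by (simp add: right_diff_distrib sum_subtractf)

end

section \<open>Strictness and exact sequences\<close>

lemma sum3_nonneg_eq_0:
  fixes a b c :: "'i \<Rightarrow> int"
  assumes "finite S" "\<And>p. 0 \<le> a p" "\<And>p. 0 \<le> b p" "\<And>p. 0 \<le> c p"
    and "(\<Sum>p\<in>S. a p + b p + c p) \<le> 0" "p \<in> S"
  shows "a p = 0" "b p = 0" "c p = 0"
proof -
  have nonneg: "0 \<le> a p + b p + c p" for p
    using assms(2-4)[of p] by simp
  then have "(\<Sum>p\<in>S. a p + b p + c p) = 0"
    using assms(5) sum_nonneg[of S "\<lambda>p. a p + b p + c p"] by fastforce
  then have "a p + b p + c p = 0"
    using sum_nonneg_eq_0_iff[OF assms(1), of "\<lambda>p. a p + b p + c p"] nonneg assms(6) by blast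
  then show "a p = 0" "b p = 0" "c p = 0"
    using assms(2-4)[of p] by linarith+
qed

text \<open>Compatibility is assumed only as inclusions; strictness is derived from them
  below.\<close>

locale trifiltered_exact =
  A: trifiltered_space sA BA WA FA GA M +
  H: trifiltered_space sH BH WH FH GH M +
  B: trifiltered_space sB BB WB FB GB M +
  f: Vector_Spaces.linear sA sH f +
  g: Vector_Spaces.linear sH sB g
  for sA :: "'k::field \<Rightarrow> 'a::ab_group_add \<Rightarrow> 'a" and BA WA FA GA
    and sH :: "'k \<Rightarrow> 'h::ab_group_add \<Rightarrow> 'h" and BH WH FH GH
    and sB :: "'k \<Rightarrow> 'b::ab_group_add \<Rightarrow> 'b" and BB WB FB GB
    and M :: int and f :: "'a \<Rightarrow> 'h" and g :: "'h \<Rightarrow> 'b" +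
  assumes inj: "inj f" and exact: "range f = {x. g x = 0}" and surj: "surj g"
    and f_W: "f ` WA n \<subseteq> WH n" and f_F: "f ` FA n \<subseteq> FH n" and f_G: "f ` GA n \<subseteq> GH n"
    and g_W: "g ` WH n \<subseteq> WB n" and g_F: "g ` FH n \<subseteq> FB n" and g_G: "g ` GH n \<subseteq> GB n"
begin

abbreviation K :: "'h set" where
  "K \<equiv> {x. g x = 0}"

lemma dim_f_image:
  assumes "A.subspace S"
  shows "H.dim (f ` S) = A.dim S"
proof -
  interpret AH: finite_dimensional_vector_space_pair_1 sA BA sH ..
  show ?thesis
    by (rule AH.dim_image_eq[OF f.linear_axioms]) (rule inj_on_subset[OF inj subset_UNIV])
qed

lemma rank_nullity_g:
  assumes "H.subspace S"
  shows "H.dim S = H.dim (S \<inter> K) + B.dim (g ` S)"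
proof -
  interpret HB: finite_dimensional_vector_space_pair sH BH sB BB ..
  show ?thesis
    using HB.rank_nullity[OF g.linear_axioms assms] .
qed

lemma dim_kernel: "H.dim K = A.dim UNIV"
  using dim_f_image[OF A.subspace_UNIV] exact by simp

lemma dim_UNIV_add: "H.dim UNIV = A.dim UNIV + B.dim UNIV"
  using rank_nullity_g[OF H.subspace_UNIV] dim_kernel surj by simp

lemma dim_sub_le:
  assumes "A.subspace S" "f ` S \<subseteq> T"
  shows "A.dim S \<le> H.dim (T \<inter> K)"
proof -
  have "f ` S \<subseteq> T \<inter> K"
    using assms exact by blast
  then show ?thesis
    using H.dim_subset dim_f_image[OF assms(1)] by metis
qed

lemma dim_quot_le:
  assumes "H.subspace T" "g ` T \<subseteq> R"
  shows "H.dim T \<le> H.dim (T \<inter> K) + B.dim R"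
  using rank_nullity_g[OF assms(1)] B.dim_subset[OF assms(2)] by simp

text \<open>
  The weight of \<open>f(A)\<close> with the filtrations induced from \<open>H\<close> is at most the extremal value
  \<open>3 M dim A\<close>, which the filtrations of \<open>A\<close> attain although they are termwise smaller.
  So the two agree.
\<close>

lemma dim_sub_eq:
  assumes "p \<in> {-M<..M}"
  shows "H.dim (FH p \<inter> K) = A.dim (FA p)" "H.dim (GH p \<inter> K) = A.dim (GA p)"
    "H.dim (WH (p - 1) \<inter> K) = A.dim (WA (p - 1))"
proof -
  define a where "a p = int (H.dim (FH p \<inter> K)) - int (A.dim (FA p))" for p
  define b where "b p = int (H.dim (GH p \<inter> K)) - int (A.dim (GA p))" for p
  define c where "c p = int (H.dim (WH (p - 1) \<inter> K)) - int (A.dim (WA (p - 1)))" for p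
  have nonneg: "0 \<le> a p" "0 \<le> b p" "0 \<le> c p" for p
    unfolding a_def b_def c_def
    using dim_sub_le[OF A.subspace_F f_F] dim_sub_le[OF A.subspace_G f_G] dim_sub_le[OF A.subspace_W f_W]
    by simp_all
  have "(\<Sum>p\<in>{-M<..M}. a p + b p + c p) = H.weight K - A.weight UNIV"
    unfolding H.weight_def A.weight_def sum_subtractf[symmetric]
    by (rule sum.cong) (simp_all add: a_def b_def c_def)
  also have "\<dots> \<le> 0"
    using H.weight_le[OF g.subspace_kernel] dim_kernel unfolding A.weight_UNIV by simp
  finally have "(\<Sum>p\<in>{-M<..M}. a p + b p + c p) \<le> 0" .
  from sum3_nonneg_eq_0[OF finite_greaterThanAtMost_int nonneg this assms]
  show "H.dim (FH p \<inter> K) = A.dim (FA p)" "H.dim (GH p \<inter> K) = A.dim (GA p)"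
    "H.dim (WH (p - 1) \<inter> K) = A.dim (WA (p - 1))"
    unfolding a_def b_def c_def by simp_all
qed

text \<open>The slope argument on the quotient side: the termwise defects are nonnegative by
  \<open>dim_quot_le\<close>. Their sum is at most zero, since \<open>B\<close> and \<open>H\<close>
  attain the extremal weight and the kernel does not exceed it.\<close>

lemma dim_add_inside:
  assumes "p \<in> {-M<..M}"
  shows "H.dim (FH p) = A.dim (FA p) + B.dim (FB p)" "H.dim (GH p) = A.dim (GA p) + B.dim (GB p)"
    "H.dim (WH (p - 1)) = A.dim (WA (p - 1)) + B.dim (WB (p - 1))"
proof -
  define a where "a p = int (B.dim (FB p)) + int (H.dim (FH p \<inter> K)) - int (H.dim (FH p))" for p
  define b where "b p = int (B.dim (GB p)) + int (H.dim (GH p \<inter> K)) - int (H.dim (GH p))" for p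
  define c where "c p = int (B.dim (WB (p - 1))) + int (H.dim (WH (p - 1) \<inter> K)) - int (H.dim (WH (p - 1)))" for p
  have nonneg: "0 \<le> a p" "0 \<le> b p" "0 \<le> c p" for p
    unfolding a_def b_def c_def
    using dim_quot_le[OF H.subspace_F g_F, of p] dim_quot_le[OF H.subspace_G g_G, of p]
      dim_quot_le[OF H.subspace_W g_W, of "p - 1"]
    by linarith+
  have "(\<Sum>p\<in>{-M<..M}. a p + b p + c p) = B.weight UNIV + H.weight K - H.weight UNIV"
    unfolding H.weight_def B.weight_def sum_subtractf[symmetric] sum.distrib[symmetric]
    by (rule sum.cong) (simp_all add: a_def b_def c_def)
  also have "\<dots> \<le> 0"
    using H.weight_le[OF g.subspace_kernel] unfolding B.weight_UNIV H.weight_UNIV dim_UNIV_add dim_kernel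
    by (simp add: algebra_simps)
  finally have "(\<Sum>p\<in>{-M<..M}. a p + b p + c p) \<le> 0" .
  from sum3_nonneg_eq_0[OF finite_greaterThanAtMost_int nonneg this assms]
  show "H.dim (FH p) = A.dim (FA p) + B.dim (FB p)" "H.dim (GH p) = A.dim (GA p) + B.dim (GB p)"
    "H.dim (WH (p - 1)) = A.dim (WA (p - 1)) + B.dim (WB (p - 1))"
    unfolding a_def b_def c_def using dim_sub_eq[OF assms] by simp_all
qed

section \<open>Additivity of dimensions and strictness at all indices\<close>

lemma dim_F_add: "H.dim (FH p) = A.dim (FA p) + B.dim (FB p)"
  using dim_add_inside(1)[of p] dim_UNIV_add
  by (cases "p \<in> {-M<..M}") (auto simp: not_less not_le A.F_low H.F_low B.F_low A.F_high H.F_high B.F_high)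

lemma dim_G_add: "H.dim (GH p) = A.dim (GA p) + B.dim (GB p)"
  using dim_add_inside(2)[of p] dim_UNIV_add
  by (cases "p \<in> {-M<..M}") (auto simp: not_less not_le A.G_low H.G_low B.G_low A.G_high H.G_high B.G_high)

lemma W_dim_add: "H.W_dim n = A.W_dim n + B.W_dim n"
  \<comment> \<open>The weight involves \<open>W (p - 1)\<close>, hence the shift to
    \<open>n + 1\<close>.\<close>
  using dim_add_inside(3)[of "n + 1"] dim_UNIV_add
  by (cases "n + 1 \<in> {-M<..M}")
    (auto simp: not_less not_le A.W_dim_def B.W_dim_def H.W_dim_def A.W_low H.W_low B.W_low A.W_high H.W_high B.W_high)

text \<open>Equality of dimensions turns the inclusion \<open>f_F\<close> into strictness.\<close>

lemma strict_F: "f ` FA p = FH p \<inter> K"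
proof (rule H.subspace_dim_equal)
  have "H.dim (FH p \<inter> K) = A.dim (FA p)"
    using dim_sub_eq(1)[of p] dim_kernel
    by (cases "p \<in> {-M<..M}") (auto simp: not_less not_le A.F_low H.F_low A.F_high H.F_high H.dim_Int_zero)
  then show "H.dim (FH p \<inter> K) \<le> H.dim (f ` FA p)"
    by (simp add: dim_f_image A.subspace_F)
  show "f ` FA p \<subseteq> FH p \<inter> K"
    using f_F exact by blast
qed (intro f.subspace_image H.subspace_inter A.subspace_F H.subspace_F g.subspace_kernel)+

lemma strict_G: "f ` GA p = GH p \<inter> K"
proof (rule H.subspace_dim_equal)
  have "H.dim (GH p \<inter> K) = A.dim (GA p)"
    using dim_sub_eq(2)[of p] dim_kernel
    by (cases "p \<in> {-M<..M}") (auto simp: not_less not_le A.G_low H.G_low A.G_high H.G_high H.dim_Int_zero)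
  then show "H.dim (GH p \<inter> K) \<le> H.dim (f ` GA p)"
    by (simp add: dim_f_image A.subspace_G)
  show "f ` GA p \<subseteq> GH p \<inter> K"
    using f_G exact by blast
qed (intro f.subspace_image H.subspace_inter A.subspace_G H.subspace_G g.subspace_kernel)+

text \<open>Left exactness: by strictness the kernel of \<open>g\<close> on
  \<open>FH p \<inter> GH q\<close> comes from \<open>A\<close>, while the image is merely contained
  in \<open>FB p \<inter> GB q\<close>.\<close>

lemma FG_dim_le: "H.FG_dim p q \<le> A.FG_dim p q + B.FG_dim p q"
proof -
  have "f ` (FA p \<inter> GA q) = FH p \<inter> GH q \<inter> K"
    using strict_F strict_G by (auto simp: image_Int[OF inj])
  then have "H.dim (FH p \<inter> GH q \<inter> K) = A.dim (FA p \<inter> GA q)"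
    using dim_f_image[of "FA p \<inter> GA q"] A.subspace_F A.subspace_G by (simp add: A.subspace_inter)
  moreover have "H.dim (FH p \<inter> GH q) \<le> H.dim (FH p \<inter> GH q \<inter> K) + B.dim (FB p \<inter> GB q)"
    using g_F g_G by (intro dim_quot_le H.subspace_inter H.subspace_F H.subspace_G) blast
  ultimately show ?thesis
    by (simp add: A.FG_dim_def B.FG_dim_def H.FG_dim_def)
qed

text \<open>Here one filtration is zero or everything, so the intersection is zero or a single step,
  where dimensions are additive. This provides the border condition of
  \<open>sum_diff2_square\<close>.\<close>

lemma FG_dim_add_outside:
  assumes "\<bar>p\<bar> \<ge> M \<or> \<bar>q\<bar> \<ge> M"
  shows "H.FG_dim p q = A.FG_dim p q + B.FG_dim p q"
proof -
  consider "p \<ge> M \<or> q \<ge> M" | "p \<le> -M" | "q \<le> -M"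
    using assms by linarith
  then show ?thesis
    by cases (auto simp: A.FG_dim_def B.FG_dim_def H.FG_dim_def A.F_low H.F_low B.F_low A.F_high H.F_high B.F_high
        A.G_low H.G_low B.G_low A.G_high H.G_high B.G_high dim_F_add dim_G_add
        A.dim_Int_zero B.dim_Int_zero H.dim_Int_zero)
qed

lemma level_superadditive: "A.level + B.level \<le> H.level"
proof -
  \<comment> \<open>The dimension of the cokernel of \<open>FH p \<inter> GH q\<close> in
    \<open>FB p \<inter> GB q\<close>.\<close>
  define e where "e p q = A.FG_dim p q + B.FG_dim p q - H.FG_dim p q" for p q
  let ?S = "\<lambda>c. \<Sum>p\<in>{-M..M}. \<Sum>q\<in>{-M..M}. (p + q)\<^sup>2 * diff2 c p q"
  have "H.level - A.level - B.level = ?S A.FG_dim + ?S B.FG_dim - ?S H.FG_dim"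
    by (simp add: A.level_eq B.level_eq H.level_eq W_dim_add algebra_simps sum.distrib sum_subtractf)
  also have "\<dots> = ?S e"
    by (simp add: diff2_def e_def algebra_simps sum.distrib sum_subtractf)
  also have "\<dots> = 2 * (\<Sum>p\<in>{-M..M}. \<Sum>q\<in>{-M..M}. e p q)"
    by (rule sum_diff2_square) (simp add: e_def FG_dim_add_outside)
  also have "\<dots> \<ge> 0"
    using FG_dim_le by (simp add: e_def sum_nonneg)
  finally show ?thesis by simp
qed

end

section \<open>Mixed Hodge structures\<close>

text \<open>A real spanning set, placed in the first component, spans over the complex numbers
  because \<open>(x, y) = (x, 0) + i (y, 0)\<close>; a finite basis is extracted from it.\<close>

lemma finite_dimensional_cplx:
  fixes E :: "'a::real_vector set"
  assumes "finite E" "span E = UNIV"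
  obtains B :: "'a cplx set" where "finite_dimensional_vector_space cscale B"
proof -
  let ?E = "(\<lambda>e. (e, 0)) ` E"
  have real: "(x, 0) \<in> cplx.span ?E" for x
  proof -
    have "x \<in> span E"
      using assms by simp
    then show ?thesis
    proof (induction rule: span_induct_alt)
      case base
      then show ?case
        using cplx.span_zero[of ?E] by (simp add: zero_prod_def)
    next
      case (step r e y)
      have "(e, 0) \<in> cplx.span ?E"
        using step(1) by (intro cplx.span_base) auto
      then have "cscale (complex_of_real r) (e, 0) + (y, 0) \<in> cplx.span ?E"
        by (intro cplx.span_add cplx.span_scale step)
      then show ?case
        by (simp add: cscale_def[of "complex_of_real r"])
    qed
  qed
  have "v \<in> cplx.span ?E" for v
  proof -
    have "(fst v, 0) + cscale \<i> (snd v, 0) \<in> cplx.span ?E"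
      by (intro cplx.span_add cplx.span_scale real)
    then show ?thesis
      by (simp add: cscale_def[of \<i>])
  qed
  then have E: "cplx.span ?E = UNIV"
    by auto
  obtain B where B: "B \<subseteq> ?E" "cplx.independent B" "?E \<subseteq> cplx.span B"
    using cplx.maximal_independent_subset by blast
  have "cplx.span B = UNIV"
    using cplx.span_mono[OF B(3)] E by (simp add: cplx.span_span top.extremum_unique)
  then have "finite_dimensional_vector_space cscale B"
    using B assms(1) by unfold_locales (auto intro: finite_subset)
  then show thesis ..
qed

lemma conj_vec_conj_vec: "conj_vec (conj_vec v) = v"
  by (simp add: conj_vec_def)

lemma Fbar_eq: "Fbar H q = {v. conj_vec v \<in> Ffilt H q}"
  unfolding Fbar_def by (force simp: conj_vec_conj_vec image_iff)

lemma subspace_Fbar: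
  fixes H :: "'a::real_vector hodge_data"
  assumes "cplx.subspace (Ffilt H q)"
  shows "cplx.subspace (Fbar H q)"
proof -
  have "conj_vec (v + v') = conj_vec v + conj_vec v'" "conj_vec (cscale c v) = cscale (cnj c) (conj_vec v)"
    "conj_vec (0 :: 'a cplx) = 0" for v v' :: "'a cplx" and c
    by (simp_all add: conj_vec_def cscale_def prod_eq_iff)
  then show ?thesis
    using assms by (simp add: cplx.subspace_def Fbar_eq)
qed

lemma real_MHS_trifiltered:
  assumes "real_MHS (H :: 'a::real_vector hodge_data)"
  obtains B M where "\<forall>M'\<ge>M. trifiltered_space cscale B (WC H) (Ffilt H) (Fbar H) M'"
proof -
  have subW: "subspace (Wfilt H n)" and monoW: "mono (Wfilt H)"
    and UnW: "(\<Union>n. Wfilt H n) = UNIV" and IntW: "(\<Inter>n. Wfilt H n) = {0}"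
    and subF: "cplx.subspace (Ffilt H p)" and antiF: "antimono (Ffilt H)"
    and UnF: "(\<Union>p. Ffilt H p) = UNIV" and IntF: "(\<Inter>p. Ffilt H p) = {0}" for n p
    using assms by (auto simp: real_MHS_def)
  have gr: "subquot_zero (gr_dec (Ffilt H) p (gr_dec (Fbar H) q (gr_inc (WC H) n whole)))"
    if "p + q \<noteq> n" for p q n
    using assms that by (simp add: real_MHS_def)
  obtain E :: "'a set" where "finite E" "span E = UNIV"
    using assms by (auto simp: real_MHS_def)
  then obtain B :: "'a cplx set" where B: "finite_dimensional_vector_space cscale B"
    by (rule finite_dimensional_cplx)
  interpret fin: finite_dimensional_vector_space cscale B by (rule B)
  have subG: "cplx.subspace (Fbar H p)" for p
    by (rule subspace_Fbar[OF subF])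
  have antiG: "antimono (Fbar H)"
    using antiF by (auto simp: antimono_def Fbar_eq)
  have UnG: "(\<Union>p. Fbar H p) = UNIV"
    using UnF by (auto simp: Fbar_eq)
  have IntG: "(\<Inter>p. Fbar H p) = {0}"
  proof -
    have "(\<Inter>p. Fbar H p) = {v. conj_vec v \<in> (\<Inter>p. Ffilt H p)}"
      by (auto simp: Fbar_eq)
    moreover have "conj_vec v = 0 \<longleftrightarrow> v = 0" for v :: "'a cplx"
      by (simp add: conj_vec_def prod_eq_iff)
    ultimately show ?thesis
      unfolding IntF by simp
  qed
  have subWC: "cplx.subspace (WC H n)" for n
    using subW[of n] unfolding WC_def cplx.subspace_def cscale_def
    by (auto simp: zero_prod_def intro!: subspace_0 subspace_add subspace_diff subspace_scale)
  have monoWC: "mono (WC H)"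
    using monoW unfolding mono_def WC_def by blast
  \<comment> \<open>The index is negated because \<open>antimono_subspaces_stable\<close> is stated
    for decreasing filtrations.\<close>
  have UnWC: "(\<Union>n. WC H (-n)) = UNIV"
  proof -
    have "v \<in> (\<Union>n. WC H (-n))" for v
    proof -
      obtain a b where "fst v \<in> Wfilt H a" "snd v \<in> Wfilt H b"
        using UnW by blast
      then have "v \<in> WC H (- (- max a b))"
        using monoD[OF monoW, of a "max a b"] monoD[OF monoW, of b "max a b"]
        by (auto simp: WC_def mem_Times_iff)
      then show ?thesis by blast
    qed
    then show ?thesis by blast
  qed
  have IntWC: "(\<Inter>n. WC H (-n)) = {0}"
  proof -
    have "v = 0" if "\<And>n. v \<in> WC H (-n)" for v
    proof -
      have "fst v \<in> Wfilt H n" "snd v \<in> Wfilt H n" for n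
        using that[of "-n"] by (auto simp: WC_def mem_Times_iff)
      then have "fst v \<in> (\<Inter>n. Wfilt H n)" "snd v \<in> (\<Inter>n. Wfilt H n)"
        by blast+
      then show ?thesis
        unfolding IntW by (simp add: prod_eq_iff)
    qed
    then show ?thesis
      using cplx.subspace_0[OF subWC] by blast
  qed
  obtain m1 where m1: "\<And>p. p \<le> -m1 \<Longrightarrow> Ffilt H p = UNIV" "\<And>p. p \<ge> m1 \<Longrightarrow> Ffilt H p = {0}"
    using fin.antimono_subspaces_stable[of "Ffilt H"] subF antiF UnF IntF by blast
  obtain m2 where m2: "\<And>p. p \<le> -m2 \<Longrightarrow> Fbar H p = UNIV" "\<And>p. p \<ge> m2 \<Longrightarrow> Fbar H p = {0}"
    using fin.antimono_subspaces_stable[of "Fbar H"] subG antiG UnG IntG by blast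
  have "antimono (\<lambda>n. WC H (-n))"
    using monoWC by (simp add: antimono_def mono_def)
  then obtain m3 where m3: "\<And>n. n \<le> -m3 \<Longrightarrow> WC H (-n) = UNIV" "\<And>n. n \<ge> m3 \<Longrightarrow> WC H (-n) = {0}"
    using fin.antimono_subspaces_stable[of "\<lambda>n. WC H (-n)"] subWC UnWC IntWC by blast
  have m3': "n \<le> -m3 \<Longrightarrow> WC H n = {0}" "n \<ge> m3 \<Longrightarrow> WC H n = UNIV" for n
    using m3(2)[of "-n"] m3(1)[of "-n"] by simp_all
  show thesis
  proof (rule that, intro allI impI)
    fix M' :: int assume "M' \<ge> max 0 (max m1 (max m2 m3))"
    then show "trifiltered_space cscale B (WC H) (Ffilt H) (Fbar H) M'"
      by unfold_locales
        (simp_all add: subWC monoWC subF antiF subG antiG m1 m2 m3' gr)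
  qed
qed

lemma splitting_level_eq:
  assumes "trifiltered_space cscale B (WC H) (Ffilt H) (Fbar H) M"
  shows "splitting_level H =
    1 / 2 * real_of_int (trifiltered_space.level cscale (WC H) (Ffilt H) (Fbar H) M)"
proof -
  interpret trifiltered_space cscale B "WC H" "Ffilt H" "Fbar H" M by fact
  \<comment> \<open>Since \<open>subquot_dim\<close> is a truncated difference, the inclusions in
    \<open>dim_gr_gr_gr\<close> and \<open>dim_gr_F_gr_G\<close> are needed too.\<close>
  have h: "real (hodge_h H p q) = real_of_int (diff2 (gr_FG_dim (p + q)) p q)" for p q
    unfolding hodge_h_def subquot_dim_def dim_gr_gr_gr(2)[symmetric]
    using dim_subset[OF dim_gr_gr_gr(1)[where n = "p + q"]] by (simp add: of_nat_diff)
  have s: "real (hodge_s H p q) = real_of_int (diff2 FG_dim p q)" for p q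
    unfolding hodge_s_def subquot_dim_def dim_gr_F_gr_G(2)[symmetric]
    using dim_subset[OF dim_gr_F_gr_G(1)] by (simp add: of_nat_diff)
  let ?t = "\<lambda>(p, q). (of_int (p + q))\<^sup>2 * (real (hodge_h H p q) - real (hodge_s H p q))"
  \<comment> \<open>\<open>Sum_any\<close> defaults to 0 on infinite support, so the support is
    first confined to a finite square.\<close>
  have "Sum_any ?t = sum ?t ({-M..M} \<times> {-M..M})"
  proof (rule Sum_any.expand_superset)
    show "{a. ?t a \<noteq> 0} \<subseteq> {-M..M} \<times> {-M..M}"
      by (clarify, rule ccontr) (simp add: h s diff2_outside)
  qed simp
  also have "\<dots> = real_of_int level"
    unfolding level_def by (simp add: h s sum.cartesian_product split_beta)
  finally show ?thesis
    by (simp add: splitting_level_def)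
qed

lemma linear_complexify:
  assumes "linear f"
  shows "Vector_Spaces.linear cscale cscale (map_prod f f)"
  by unfold_locales (simp_all add: cscale_def map_prod_def split_beta linear_add[OF assms]
      linear_diff[OF assms] linear_scale[OF assms])

lemma MHS_morphism_complexify:
  assumes "MHS_morphism H K f"
  shows "map_prod f f ` WC H n \<subseteq> WC K n" "map_prod f f ` Ffilt H n \<subseteq> Ffilt K n"
    "map_prod f f ` Fbar H n \<subseteq> Fbar K n"
proof -
  have f: "linear f" "f ` Wfilt H n \<subseteq> Wfilt K n" "map_prod f f ` Ffilt H n \<subseteq> Ffilt K n"
    using assms by (auto simp: MHS_morphism_def)
  show "map_prod f f ` WC H n \<subseteq> WC K n" "map_prod f f ` Ffilt H n \<subseteq> Ffilt K n"
    using f by (auto simp: WC_def)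
  have "conj_vec (map_prod f f v) = map_prod f f (conj_vec v)" for v
    by (simp add: conj_vec_def linear_neg[OF f(1)])
  then show "map_prod f f ` Fbar H n \<subseteq> Fbar K n"
    using f(3) by (auto simp: Fbar_eq)
qed

theorem mainTheorem8:
  fixes A :: "'a::real_vector hodge_data"
    and B :: "'b::real_vector hodge_data"
    and H :: "'h::real_vector hodge_data"
    and f :: "'a \<Rightarrow> 'h" and g :: "'h \<Rightarrow> 'b"
  assumes "real_MHS A" and "real_MHS B" and "real_MHS H"
    and "MHS_short_exact A f H g B"
  shows "splitting_level H \<ge> splitting_level A + splitting_level B"
proof -
  obtain BA MA where A: "\<forall>M\<ge>MA. trifiltered_space cscale BA (WC A) (Ffilt A) (Fbar A) M"
    using real_MHS_trifiltered[OF assms(1)] .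
  obtain BB MB where B: "\<forall>M\<ge>MB. trifiltered_space cscale BB (WC B) (Ffilt B) (Fbar B) M"
    using real_MHS_trifiltered[OF assms(2)] .
  obtain BH MH where H: "\<forall>M\<ge>MH. trifiltered_space cscale BH (WC H) (Ffilt H) (Fbar H) M"
    using real_MHS_trifiltered[OF assms(3)] .
  define M where "M = max MA (max MB MH)"
  have ABH: "trifiltered_space cscale BA (WC A) (Ffilt A) (Fbar A) M"
    "trifiltered_space cscale BH (WC H) (Ffilt H) (Fbar H) M"
    "trifiltered_space cscale BB (WC B) (Ffilt B) (Fbar B) M"
    using A B H by (simp_all add: M_def)
  have f: "MHS_morphism A H f" "inj f" "range f = {x. g x = 0}" and g: "MHS_morphism H B g" "surj g"
    using assms(4) by (simp_all add: MHS_short_exact_def)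
  have lin: "linear f" "linear g"
    using f(1) g(1) by (simp_all add: MHS_morphism_def)
  \<comment> \<open>The complexified maps act componentwise, so exactness passes from
    \<open>f\<close> and \<open>g\<close> to them.\<close>
  have "trifiltered_exact cscale BA (WC A) (Ffilt A) (Fbar A) cscale BH (WC H) (Ffilt H) (Fbar H)
    cscale BB (WC B) (Ffilt B) (Fbar B) M (map_prod f f) (map_prod g g)"
  proof (intro trifiltered_exact.intro trifiltered_exact_axioms.intro ABH linear_complexify lin
      MHS_morphism_complexify f(1) g(1))
    show "inj (map_prod f f)"
      by (rule prod.inj_map[OF f(2) f(2)])
    show "range (map_prod f f) = {x. map_prod g g x = 0}"
    proof -
      have "range (map_prod f f) = range f \<times> range f"
        using map_prod_surj_on[of f UNIV "range f" f UNIV "range f"] by simp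
      then show ?thesis
        unfolding f(3) by (auto simp: zero_prod_def)
    qed
    show "surj (map_prod g g)"
      using g(2) by (simp add: map_prod_surj)
  qed
  from trifiltered_exact.level_superadditive[OF this] show ?thesis
    unfolding ABH[THEN splitting_level_eq]
    by (simp flip: of_int_add distrib_left)
qed

end
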